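(* Let $N,\mu,\nu\in\mathbb N_+$, $M=N\mu$, $B_*=N\mu\nu$, let $f\colon\mathbb R\to(0,\infty)$ be an arbitrary strictly positive function, and let $\{S(t)\}_{t\ge 0}$ be the $f$-biased exchange process with collective debt limit with state space $\mathcal C(N,M,B_* )$ (defined in the context), started from an arbitrary initial state in $\mathcal C(N,M,B_* )$. Then for every agent $i\in\{1,\dots,N\}$ and every $n\in\mathbb Z$, $$\lim_{t\to\infty}\mathbb P[S_i(t)=n]=\sum_{\xi\in\mathcal C(N,M,B_* )\,:\,\xi(i)=n}\pi(\xi)=\frac{\displaystyle\sum_{\xi\in\mathcal C(N,M,B_* )\,:\,\xi(i)=n}\theta(\xi)}{\displaystyle\sum_{\xi\in\mathcal C(N,M,B_* )}\theta(\xi)},$$ where $$\theta(\xi)=\prod_{k=1}^N\prod_{j=-B_*}^{\xi(k)}\frac1{f(j)},\qquad \pi(\xi)=\frac{\theta(\xi)}{\sum_{\xi'\in\mathcal C(N,M,B_* )}\theta(\xi')}.$$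
   Context: State space: $\mathcal C(N,M,B_* )$ is the set of all $\xi\colon\{1,\dots,N\}\to\mathbb Z$ with $\sum_{i=1}^N\xi(i)=M$, $-B_*\le \xi(i)\le M+B_*$ for every $i$, and total debt $\sum_{i=1}^N\max(-\xi(i),0)\le B_*$. Here $\xi(i)$ is the number of dollars of agent $i$ (negative values mean debt to a central bank). Process: $\{S(t)\}_{t\ge0}$, $S(t)=(S_1(t),\dots,S_N(t))$, is the continuous-time Markov chain on $\mathcal C(N,M,B_* )$ defined as follows. The cash in the bank in state $\xi$ is $B_c(\xi)=B_*-\sum_{i=1}^N\max(-\xi(i),0)\ge 0$. For each ordered pair $(i,j)$ with $i\ne j$, the chain jumps from $\xi$ to the configuration obtained by replacing $\xi(i)$ by $\xi(i)-1$ and $\xi(j)$ by $\xi(j)+1$ at rate $f(\xi(i))/N$ if $\xi(i)\ge1$ or $B_c(\xi)\ge1$, and at rate $0$ otherwise. There are no other transitions. *)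

theory Defs
  imports "HOL-Probability.Probability"
begin

definition transition_function :: "'s set \<Rightarrow> (real \<Rightarrow> 's \<Rightarrow> 's \<Rightarrow> real) \<Rightarrow> bool" where
  "transition_function E p \<longleftrightarrow>
     (\<forall>t\<ge>0. \<forall>x\<in>E. (\<forall>y\<in>E. 0 \<le> p t x y) \<and> (\<Sum>y\<in>E. p t x y) = 1) \<and>
     (\<forall>x\<in>E. \<forall>y\<in>E. p 0 x y = (if x = y then 1 else 0)) \<and>
     (\<forall>s\<ge>0. \<forall>t\<ge>0. \<forall>x\<in>E. \<forall>z\<in>E. p (s + t) x z = (\<Sum>y\<in>E. p s x y * p t y z))"

text \<open>
  The rates \<open>q x y\<close> are the derivatives at time 0 of the transition probabilities,
  for \<open>x \<noteq> y\<close> only. On a finite state space the rows of \<open>p t\<close> sum to 1, so the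
  derivative of \<open>p t x x\<close> is then minus the total rate of leaving \<open>x\<close>; the value
  \<open>q x x\<close> plays no role.
\<close>

definition has_jump_rates ::
    "'s set \<Rightarrow> (real \<Rightarrow> 's \<Rightarrow> 's \<Rightarrow> real) \<Rightarrow> ('s \<Rightarrow> 's \<Rightarrow> real) \<Rightarrow> bool" where
  "has_jump_rates E p q \<longleftrightarrow>
     (\<forall>x\<in>E. \<forall>y\<in>E. x \<noteq> y \<longrightarrow> ((\<lambda>t. p t x y) has_real_derivative q x y) (at 0 within {0..}))"

text \<open>The conditioning event below contains the whole observed past, and has positive probability.\<close>

definition markov_with_transitions ::
    "'w measure \<Rightarrow> 's set \<Rightarrow> (real \<Rightarrow> 's \<Rightarrow> 's \<Rightarrow> real) \<Rightarrow> (real \<Rightarrow> 'w \<Rightarrow> 's) \<Rightarrow> bool" where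
  "markov_with_transitions \<Omega> E p S \<longleftrightarrow>
     (\<forall>(n::nat) (\<tau>::nat \<Rightarrow> real) (x::nat \<Rightarrow> 's).
        0 \<le> \<tau> 0 \<longrightarrow> (\<forall>k\<le>n. \<tau> k < \<tau> (Suc k)) \<longrightarrow> (\<forall>k\<le>Suc n. x k \<in> E) \<longrightarrow>
        \<P>(\<omega> in \<Omega>. \<forall>k\<le>n. S (\<tau> k) \<omega> = x k) > 0 \<longrightarrow>
        \<P>(\<omega> in \<Omega>. S (\<tau> (Suc n)) \<omega> = x (Suc n) \<bar> \<forall>k\<le>n. S (\<tau> k) \<omega> = x k)
          = p (\<tau> (Suc n) - \<tau> n) (x n) (x (Suc n)))"

text \<open>
  Time-homogeneous continuous-time Markov chain on a finite state space, with right-continuous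
  paths for the discrete topology. Times are reals; only the times \<open>t \<ge> 0\<close> are constrained.
\<close>

definition finite_ctmc ::
    "'w measure \<Rightarrow> 's set \<Rightarrow> ('s \<Rightarrow> 's \<Rightarrow> real) \<Rightarrow> (real \<Rightarrow> 'w \<Rightarrow> 's) \<Rightarrow> bool" where
  "finite_ctmc \<Omega> E q S \<longleftrightarrow>
     prob_space \<Omega> \<and> finite E \<and>
     (\<forall>t\<ge>0. S t \<in> measurable \<Omega> (count_space E)) \<and>
     (AE \<omega> in \<Omega>. \<forall>t\<ge>0. \<forall>\<^sub>F s in at_right t. S s \<omega> = S t \<omega>) \<and>
     (\<exists>p. transition_function E p \<and> has_jump_rates E p q \<and> markov_with_transitions \<Omega> E p S)"

definition debt :: "nat \<Rightarrow> (nat \<Rightarrow> int) \<Rightarrow> int" where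
  "debt N \<xi> = (\<Sum>i\<in>{1..N}. max (- \<xi> i) 0)"

text \<open>
  Maps from \<open>{1..N}\<close> to the integers are taken extensional, i.e. \<open>undefined\<close> outside \<open>{1..N}\<close>,
  so that each configuration is represented exactly once.
\<close>

definition configs :: "nat \<Rightarrow> nat \<Rightarrow> nat \<Rightarrow> (nat \<Rightarrow> int) set" where
  "configs N M B =
     {\<xi> \<in> {1..N} \<rightarrow>\<^sub>E UNIV. (\<Sum>i\<in>{1..N}. \<xi> i) = int M \<and>
        (\<forall>i\<in>{1..N}. - int B \<le> \<xi> i \<and> \<xi> i \<le> int M + int B) \<and> debt N \<xi> \<le> int B}"

definition bank_cash :: "nat \<Rightarrow> nat \<Rightarrow> (nat \<Rightarrow> int) \<Rightarrow> int" where
  "bank_cash N B \<xi> = int B - debt N \<xi>"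

definition give :: "nat \<Rightarrow> nat \<Rightarrow> (nat \<Rightarrow> int) \<Rightarrow> (nat \<Rightarrow> int)" where
  "give i j \<xi> = \<xi>(i := \<xi> i - 1, j := \<xi> j + 1)"

definition give_rate :: "nat \<Rightarrow> nat \<Rightarrow> (real \<Rightarrow> real) \<Rightarrow> nat \<Rightarrow> (nat \<Rightarrow> int) \<Rightarrow> real" where
  "give_rate N B f i \<xi> =
     (if \<xi> i \<ge> 1 \<or> bank_cash N B \<xi> \<ge> 1 then f (real_of_int (\<xi> i)) / real N else 0)"

definition exchange_rate ::
    "nat \<Rightarrow> nat \<Rightarrow> (real \<Rightarrow> real) \<Rightarrow> (nat \<Rightarrow> int) \<Rightarrow> (nat \<Rightarrow> int) \<Rightarrow> real" where
  "exchange_rate N B f \<xi> \<eta> =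
     (\<Sum>(i, j) \<in> {(i, j). i \<in> {1..N} \<and> j \<in> {1..N} \<and> i \<noteq> j \<and> give i j \<xi> = \<eta>}.
        give_rate N B f i \<xi>)"

definition biased_exchange_process ::
    "'w measure \<Rightarrow> nat \<Rightarrow> nat \<Rightarrow> nat \<Rightarrow> (real \<Rightarrow> real) \<Rightarrow> (real \<Rightarrow> 'w \<Rightarrow> nat \<Rightarrow> int) \<Rightarrow> bool" where
  "biased_exchange_process \<Omega> N M B f S \<longleftrightarrow>
     finite_ctmc \<Omega> (configs N M B) (exchange_rate N B f) S"

definition theta :: "nat \<Rightarrow> nat \<Rightarrow> (real \<Rightarrow> real) \<Rightarrow> (nat \<Rightarrow> int) \<Rightarrow> real" where
  "theta N B f \<xi> = (\<Prod>k\<in>{1..N}. \<Prod>j\<in>{- int B..\<xi> k}. 1 / f (real_of_int j))"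

definition stat_weight :: "nat \<Rightarrow> nat \<Rightarrow> nat \<Rightarrow> (real \<Rightarrow> real) \<Rightarrow> (nat \<Rightarrow> int) \<Rightarrow> real" where
  "stat_weight N M B f \<xi> = theta N B f \<xi> / (\<Sum>\<xi>'\<in>configs N M B. theta N B f \<xi>')"

end

theory Submission
  imports Defs
begin

text \<open>
  The weights \<open>theta\<close> satisfy detailed balance, because an exchange from \<open>i\<close> to \<open>j\<close> is allowed
  exactly when the opposite exchange is allowed afterwards. The chain is irreducible: as long as
  some agent other than agent 1 has a nonzero fortune, a suitable exchange between this agent and
  agent 1 decreases the sum of the absolute fortunes of the agents other than 1, and detailed
  balance makes these paths reversible. Therefore all entries of the transition matrix at time 1
  are positive, and by Doeblin's argument that matrix contracts the \<open>\<ell>\<^sup>1\<close> distance of the law of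
  the chain to the normalised weights by a fixed factor less than 1.
\<close>

section \<open>Convergence of finite Markov semigroups\<close>

locale finite_transition =
  fixes E :: "'s set" and p :: "real \<Rightarrow> 's \<Rightarrow> 's \<Rightarrow> real" and q :: "'s \<Rightarrow> 's \<Rightarrow> real"
  assumes finite_E: "finite E"
    and transition: "transition_function E p"
    and rates: "has_jump_rates E p q"
begin

section \<open>Elementary consequences of the semigroup axioms\<close>

lemma nonneg: "t \<ge> 0 \<Longrightarrow> x \<in> E \<Longrightarrow> y \<in> E \<Longrightarrow> 0 \<le> p t x y"
  using transition unfolding transition_function_def by blast

lemma row_sum: "t \<ge> 0 \<Longrightarrow> x \<in> E \<Longrightarrow> (\<Sum>y\<in>E. p t x y) = 1"
  using transition unfolding transition_function_def by blast

lemma at_zero: "x \<in> E \<Longrightarrow> y \<in> E \<Longrightarrow> p 0 x y = (if x = y then 1 else 0)"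
  using transition unfolding transition_function_def by blast

lemma chapman_kolmogorov:
  "s \<ge> 0 \<Longrightarrow> t \<ge> 0 \<Longrightarrow> x \<in> E \<Longrightarrow> z \<in> E \<Longrightarrow> p (s + t) x z = (\<Sum>y\<in>E. p s x y * p t y z)"
  using transition unfolding transition_function_def by blast

lemma chapman_kolmogorov_ge:
  assumes "s \<ge> 0" "t \<ge> 0" "x \<in> E" "y \<in> E" "z \<in> E"
  shows "p s x y * p t y z \<le> p (s + t) x z"
  unfolding chapman_kolmogorov[OF assms(1-3,5)]
  by (rule member_le_sum[where f = "\<lambda>y. p s x y * p t y z"])
    (use assms in \<open>auto intro!: mult_nonneg_nonneg nonneg simp: finite_E\<close>)

section \<open>Difference quotients at time 0\<close>

lemma rate_tendsto:
  assumes "x \<in> E" "y \<in> E" "x \<noteq> y"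
  shows "((\<lambda>h. p h x y / h) \<longlongrightarrow> q x y) (at_right 0)"
proof -
  have "((\<lambda>t. p t x y) has_real_derivative q x y) (at 0 within {0..})"
    using rates assms unfolding has_jump_rates_def by blast
  thus ?thesis
    using assms at_zero[of x y] by (simp add: has_field_derivative_iff at_within_Ici_at_right)
qed

text \<open>Rows sum to 1, so the diagonal quotient is minus the finite sum of the off-diagonal
  ones, and the limits add up.\<close>

lemma diag_rate_tendsto:
  assumes "x \<in> E"
  shows "((\<lambda>h. (p h x x - 1) / h) \<longlongrightarrow> - (\<Sum>y\<in>E-{x}. q x y)) (at_right 0)"
proof -
  have "((\<lambda>h. - (\<Sum>y\<in>E-{x}. p h x y / h)) \<longlongrightarrow> - (\<Sum>y\<in>E-{x}. q x y)) (at_right 0)"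
    using assms by (intro tendsto_minus tendsto_sum rate_tendsto) auto
  moreover have "\<forall>\<^sub>F h in at_right 0. - (\<Sum>y\<in>E-{x}. p h x y / h) = (p h x x - 1) / h"
    using eventually_at_right_less[of "0::real"]
  proof eventually_elim
    case (elim h)
    have "p h x x + (\<Sum>y\<in>E-{x}. p h x y) = 1"
      using row_sum[of h x] elim assms by (simp add: sum.remove[OF finite_E])
    hence "p h x x - 1 = - (\<Sum>y\<in>E-{x}. p h x y)" by linarith
    thus ?case by (simp flip: sum_divide_distrib)
  qed
  ultimately show ?thesis by (rule Lim_transform_eventually)
qed

text \<open>The quotient \<open>(p h x x - 1) / h\<close> has a finite limit, so multiplying it by
  \<open>h\<close> makes the increment vanish.\<close>

lemma diag_tendsto:
  assumes "x \<in> E"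
  shows "((\<lambda>h. p h x x) \<longlongrightarrow> 1) (at_right 0)"
proof -
  have "((\<lambda>h. (p h x x - 1) / h * h + 1) \<longlongrightarrow> - (\<Sum>y\<in>E-{x}. q x y) * 0 + 1) (at_right 0)"
    by (intro tendsto_intros diag_rate_tendsto assms)
  moreover have "\<forall>\<^sub>F h in at_right 0. (p h x x - 1) / h * h + 1 = p h x x"
    using eventually_at_right_less[of "0::real"] by eventually_elim simp
  ultimately show ?thesis by (auto intro: Lim_transform_eventually)
qed

section \<open>Positivity of the transition probabilities\<close>

text \<open>Lets one-sided limits at 0 be evaluated along the mesh sizes of equal subdivisions of
  the interval from 0 to \<open>t\<close>.\<close>

lemma filterlim_divide_Suc:
  fixes t :: real
  assumes "t > 0"
  shows "filterlim (\<lambda>n. t / real (Suc n)) (at_right 0) sequentially"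
  by (rule tendsto_imp_filterlim_at_right)
    (use assms lim_const_over_n[THEN LIMSEQ_Suc, of t] in auto)

text \<open>Being at \<open>x\<close> after each of \<open>n\<close> steps of length
  \<open>h\<close> is only one of the ways to be at \<open>x\<close> after all of them.\<close>

lemma diag_pow_le:
  assumes "x \<in> E" "h \<ge> 0"
  shows "p h x x ^ n \<le> p (real n * h) x x"
proof (induction n)
  case 0
  show ?case using assms by (simp add: at_zero)
next
  case (Suc n)
  have "p h x x ^ Suc n \<le> p h x x * p (real n * h) x x"
    using Suc assms by (auto intro!: mult_left_mono nonneg)
  also have "\<dots> \<le> p (h + real n * h) x x"
    using assms by (intro chapman_kolmogorov_ge) auto
  finally show ?case by (simp add: algebra_simps)
qed

text \<open>Cut \<open>t\<close> into equal steps so short that the return probability over one step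
  is positive; \<open>diag_pow_le\<close> combines the steps.\<close>

lemma diag_pos:
  assumes "x \<in> E" "t > 0"
  shows "p t x x > 0"
proof -
  have "\<forall>\<^sub>F h in at_right 0. p h x x > 0"
    using diag_tendsto[OF assms(1)] by (rule order_tendstoD) simp
  hence "\<forall>\<^sub>F n in sequentially. p (t / real (Suc n)) x x > 0"
    by (rule eventually_compose_filterlim) (rule filterlim_divide_Suc[OF assms(2)])
  then obtain n where n: "p (t / real (Suc n)) x x > 0"
    by (auto simp: eventually_sequentially)
  hence "0 < p (t / real (Suc n)) x x ^ Suc n" by (rule zero_less_power)
  also have "\<dots> \<le> p (real (Suc n) * (t / real (Suc n))) x x"
    using assms by (intro diag_pow_le) auto
  finally show ?thesis by simp
qed

text \<open>For \<open>x \<noteq> y\<close> a positive rate makes the jump possible within some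
  short time \<open>h < t\<close>; \<open>diag_pos\<close> covers the remaining time
  \<open>t - h\<close>.\<close>

lemma edge_pos:
  assumes "x \<in> E" "y \<in> E" "q x y > 0" "t > 0"
  shows "p t x y > 0"
proof (cases "x = y")
  case True
  thus ?thesis using diag_pos assms by simp
next
  case False
  have "\<forall>\<^sub>F h in at_right 0. p h x y / h > 0"
    using rate_tendsto[OF assms(1,2) False] assms(3) by (rule order_tendstoD)
  moreover have "\<forall>\<^sub>F h in at_right 0. h < t"
    using assms(4) by (intro eventually_at_rightI[of 0 t]) auto
  ultimately have "\<forall>\<^sub>F h in at_right 0. 0 < h \<and> h < t \<and> p h x y > 0"
    using eventually_at_right_less[of "0::real"]
    by eventually_elim (auto simp: zero_less_divide_iff)
  then obtain h where h: "0 < h" "h < t" "p h x y > 0"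
    using eventually_happens' trivial_limit_at_right_real by blast
  hence "0 < p h x y * p (t - h) y y" using diag_pos assms by simp
  also have "\<dots> \<le> p (h + (t - h)) x y" using h assms by (intro chapman_kolmogorov_ge) auto
  finally show ?thesis by simp
qed

text \<open>The induction along the path keeps \<open>t\<close> arbitrary: the last edge takes the
  second half of the time, the path before it the first half.\<close>

lemma reachable_pos:
  assumes "(x, y) \<in> {(a, b). a \<in> E \<and> b \<in> E \<and> q a b > 0}\<^sup>*" "x \<in> E" "t > 0"
  shows "y \<in> E \<and> p t x y > 0"
  using assms(1,3)
proof (induction arbitrary: t rule: rtrancl_induct)
  case base
  thus ?case using assms diag_pos by simp
next
  case (step y z)
  hence "0 < p (t / 2) x y * p (t / 2) y z" using edge_pos[of y z "t/2"] step.IH[of "t/2"] by simp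
  also have "\<dots> \<le> p (t / 2 + t / 2) x z"
    using step assms(2) by (intro chapman_kolmogorov_ge) auto
  finally show ?case using step by simp
qed

section \<open>Action on signed row vectors and stationarity\<close>

text \<open>By the triangle inequality and unit row sums, a stochastic matrix does not increase the
  l1 norm of a signed vector.\<close>

lemma signed_mass_le:
  assumes "t \<ge> 0"
  shows "(\<Sum>z\<in>E. \<bar>\<Sum>x\<in>E. v x * p t x z\<bar>) \<le> (\<Sum>x\<in>E. \<bar>v x\<bar>)"
proof -
  have "(\<Sum>z\<in>E. \<bar>\<Sum>x\<in>E. v x * p t x z\<bar>) \<le> (\<Sum>z\<in>E. \<Sum>x\<in>E. \<bar>v x\<bar> * p t x z)"
    using assms by (intro sum_mono order.trans[OF sum_abs]) (simp add: abs_mult nonneg)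
  also have "\<dots> = (\<Sum>x\<in>E. \<bar>v x\<bar> * (\<Sum>z\<in>E. p t x z))"
    by (subst sum.swap) (simp add: sum_distrib_left)
  also have "\<dots> = (\<Sum>x\<in>E. \<bar>v x\<bar>)" using assms by (simp add: row_sum)
  finally show ?thesis .
qed

lemma action_add:
  assumes "s \<ge> 0" "t \<ge> 0" "z \<in> E"
  shows "(\<Sum>x\<in>E. v x * p (s + t) x z) = (\<Sum>y\<in>E. (\<Sum>x\<in>E. v x * p s x y) * p t y z)"
proof -
  have "(\<Sum>x\<in>E. v x * p (s + t) x z) = (\<Sum>x\<in>E. \<Sum>y\<in>E. v x * p s x y * p t y z)"
    using assms by (simp add: chapman_kolmogorov sum_distrib_left mult.assoc)
  also have "\<dots> = (\<Sum>y\<in>E. (\<Sum>x\<in>E. v x * p s x y) * p t y z)"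
    by (subst sum.swap) (simp add: sum_distrib_right)
  finally show ?thesis .
qed

text \<open>
  The \<open>\<ell>\<^sup>1\<close> distance \<open>\<phi> t\<close> between \<open>w\<close> and its image under \<open>p t\<close> is subadditive in \<open>t\<close>, and
  detailed balance gives \<open>\<phi> h = o(h)\<close> at 0; hence \<open>\<phi> t \<le> n * \<phi> (t / n)\<close> tends to 0.
\<close>

lemma detailed_balance_stationary:
  assumes balance: "\<And>x y. x \<in> E \<Longrightarrow> y \<in> E \<Longrightarrow> w x * q x y = w y * q y x"
    and "t \<ge> 0" "z \<in> E"
  shows "(\<Sum>x\<in>E. w x * p t x z) = w z"
proof (cases "t = 0")
  case True
  thus ?thesis using assms by (simp add: at_zero finite_E if_distrib cong: if_cong)
next
  case False
  hence t: "t > 0" using assms by simp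
  define d where "d = (\<lambda>t z. (\<Sum>x\<in>E. w x * p t x z) - w z)"
  define \<phi> where "\<phi> = (\<lambda>t. \<Sum>z\<in>E. \<bar>d t z\<bar>)"
  have subadd: "\<phi> (s + h) \<le> \<phi> s + \<phi> h" if "s \<ge> 0" "h \<ge> 0" for s h
  proof -
    \<comment> \<open>The image of \<open>w\<close> under \<open>p s\<close> is
      \<open>w + d s\<close>; applying \<open>p h\<close> gives \<open>w + d h\<close> plus the
      image of \<open>d s\<close>.\<close>
    have "d (s + h) z = (\<Sum>y\<in>E. d s y * p h y z) + d h z" if "z \<in> E" for z
      using action_add[of s h z w] \<open>s \<ge> 0\<close> \<open>h \<ge> 0\<close> that
      by (simp add: d_def left_diff_distrib sum_subtractf)
    hence "\<phi> (s + h) \<le> (\<Sum>z\<in>E. \<bar>\<Sum>y\<in>E. d s y * p h y z\<bar> + \<bar>d h z\<bar>)"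
      unfolding \<phi>_def by (intro sum_mono) (simp add: abs_triangle_ineq)
    also have "\<dots> \<le> \<phi> s + \<phi> h"
      unfolding \<phi>_def sum.distrib using that by (intro add_right_mono signed_mass_le)
    finally show ?thesis .
  qed
  have mult: "\<phi> (real (Suc n) * h) \<le> real (Suc n) * \<phi> h" if "h \<ge> 0" for h n
  proof (induction n)
    case (Suc n)
    have "\<phi> (real (Suc (Suc n)) * h) = \<phi> (real (Suc n) * h + h)" by (simp add: algebra_simps)
    also have "\<dots> \<le> \<phi> (real (Suc n) * h) + \<phi> h" using that by (intro subadd) auto
    finally show ?case using Suc by (simp add: algebra_simps)
  qed simp
  have "((\<lambda>h. d h z / h) \<longlongrightarrow> 0) (at_right 0)" if z: "z \<in> E" for z
  proof -
    \<comment> \<open>In the limit the first sum is the inflow into \<open>z\<close> and the other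
      term the outflow; detailed balance cancels them term by term.\<close>
    have "((\<lambda>h. (\<Sum>x\<in>E-{z}. w x * (p h x z / h)) + w z * ((p h z z - 1) / h)) \<longlongrightarrow>
        (\<Sum>x\<in>E-{z}. w x * q x z) + w z * - (\<Sum>y\<in>E-{z}. q z y)) (at_right 0)"
      using z by (intro tendsto_intros rate_tendsto diag_rate_tendsto) auto
    moreover have "(\<Sum>x\<in>E-{z}. w x * q x z) = (\<Sum>y\<in>E-{z}. w z * q z y)"
      using balance z by (intro sum.cong) auto
    moreover have "(\<Sum>x\<in>E-{z}. w x * (p h x z / h)) + w z * ((p h z z - 1) / h) = d h z / h" for h
      unfolding d_def sum.remove[OF finite_E z]
      by (simp add: sum_divide_distrib diff_divide_distrib add_divide_distrib right_diff_distrib)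
    ultimately show ?thesis by (simp add: sum_distrib_left)
  qed
  hence "((\<lambda>h. \<Sum>z\<in>E. \<bar>d h z / h\<bar>) \<longlongrightarrow> (\<Sum>z\<in>E. 0)) (at_right 0)"
    by (intro tendsto_sum tendsto_rabs_zero) auto
  hence "(\<lambda>n. \<Sum>z\<in>E. \<bar>d (t / real (Suc n)) z / (t / real (Suc n))\<bar>) \<longlonglongrightarrow> 0"
    by (intro filterlim_compose[OF _ filterlim_divide_Suc[OF t]]) simp
  \<comment> \<open>The factor \<open>t\<close> turns the division by
    \<open>t / real (Suc n)\<close> into a multiplication by the number of steps.\<close>
  hence "(\<lambda>n. t * (\<Sum>z\<in>E. \<bar>d (t / real (Suc n)) z / (t / real (Suc n))\<bar>)) \<longlonglongrightarrow> t * 0"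
    by (intro tendsto_intros)
  moreover have "t * (\<Sum>z\<in>E. \<bar>d (t / real (Suc n)) z / (t / real (Suc n))\<bar>) =
      real (Suc n) * \<phi> (t / real (Suc n))" for n
    using t by (simp add: \<phi>_def sum_distrib_left abs_mult abs_divide field_simps del: of_nat_Suc)
  ultimately have "(\<lambda>n. real (Suc n) * \<phi> (t / real (Suc n))) \<longlonglongrightarrow> 0" by simp
  moreover have "\<phi> t \<le> real (Suc n) * \<phi> (t / real (Suc n))" for n
    using mult[of "t / real (Suc n)" n] t by simp
  ultimately have "\<phi> t \<le> 0" by (intro LIMSEQ_le_const) auto
  moreover have "\<phi> t \<ge> 0" unfolding \<phi>_def by (intro sum_nonneg) auto
  ultimately have "\<phi> t = 0" by simp
  thus ?thesis using assms by (simp add: \<phi>_def sum_nonneg_eq_0_iff finite_E d_def)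
qed

section \<open>Contraction and convergence to the stationary weights\<close>

text \<open>As \<open>v\<close> has total mass 0, subtracting the constant \<delta> from every
  matrix entry does not change the image of \<open>v\<close>. The remaining entries are nonnegative
  with row sums \<open>1 - real (card E) * \<delta>\<close>.\<close>

lemma doeblin_contraction:
  assumes "t \<ge> 0" and "\<And>x z. x \<in> E \<Longrightarrow> z \<in> E \<Longrightarrow> \<delta> \<le> p t x z" and "(\<Sum>x\<in>E. v x) = 0"
  shows "(\<Sum>z\<in>E. \<bar>\<Sum>x\<in>E. v x * p t x z\<bar>) \<le> (1 - real (card E) * \<delta>) * (\<Sum>x\<in>E. \<bar>v x\<bar>)"
proof -
  have "(\<Sum>x\<in>E. v x * p t x z) = (\<Sum>x\<in>E. v x * (p t x z - \<delta>))" for z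
    using assms(3) by (simp add: right_diff_distrib sum_subtractf flip: sum_distrib_right)
  hence "(\<Sum>z\<in>E. \<bar>\<Sum>x\<in>E. v x * p t x z\<bar>) \<le> (\<Sum>z\<in>E. \<Sum>x\<in>E. \<bar>v x\<bar> * (p t x z - \<delta>))"
    using assms(2) by (simp, intro sum_mono order.trans[OF sum_abs]) (simp add: abs_mult)
  also have "\<dots> = (\<Sum>x\<in>E. \<bar>v x\<bar> * (\<Sum>z\<in>E. p t x z - \<delta>))"
    by (subst sum.swap) (simp add: sum_distrib_left)
  also have "\<dots> = (\<Sum>x\<in>E. \<bar>v x\<bar> * (1 - real (card E) * \<delta>))"
    using assms(1) by (simp add: row_sum sum_subtractf)
  finally show ?thesis by (simp add: mult.commute flip: sum_distrib_right)
qed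

text \<open>The distance \<open>D\<close> to \<open>w\<close> decays geometrically along integer
  times and cannot increase in between.\<close>

theorem convergence:
  assumes balance: "\<And>x y. x \<in> E \<Longrightarrow> y \<in> E \<Longrightarrow> w x * q x y = w y * q y x"
    and irreducible: "\<And>x y. x \<in> E \<Longrightarrow> y \<in> E \<Longrightarrow>
      (x, y) \<in> {(a, b). a \<in> E \<and> b \<in> E \<and> q a b > 0}\<^sup>*"
    and mass: "(\<Sum>x\<in>E. w x) = 1"
    and x: "x \<in> E" and y: "y \<in> E"
  shows "((\<lambda>t. p t x y) \<longlongrightarrow> w y) at_top"
proof -
  define \<delta> where "\<delta> = Min ((\<lambda>(a, b). p 1 a b) ` (E \<times> E))"
  have \<delta>_le: "\<delta> \<le> p 1 a b" if "a \<in> E" "b \<in> E" for a b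
    unfolding \<delta>_def using finite_E that by (intro Min_le) auto
  have "\<delta> \<in> (\<lambda>(a, b). p 1 a b) ` (E \<times> E)"
    unfolding \<delta>_def using finite_E x by (intro Min_in) auto
  moreover have "p 1 a b > 0" if "a \<in> E" "b \<in> E" for a b
    using reachable_pos[OF irreducible[OF that] that(1), of 1] by simp
  ultimately have \<delta>_pos: "\<delta> > 0" by auto
  define r where "r = 1 - real (card E) * \<delta>"
  \<comment> \<open>The row sum 1 bounds \<open>card E\<close> copies of \<delta>; this gives
    \<open>r \<ge> 0\<close>, which the induction for \<open>pow\<close> needs to multiply
    inequalities by \<open>r\<close>.\<close>
  have "real (card E) * \<delta> \<le> (\<Sum>b\<in>E. p 1 x b)"
    using sum_bounded_below[of E \<delta> "p 1 x"] \<delta>_le x by auto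
  hence r0: "r \<ge> 0" using row_sum[of 1 x] x by (simp add: r_def)
  have "card E > 0" using finite_E x card_gt_0_iff by blast
  hence r1: "r < 1" using \<delta>_pos by (simp add: r_def)
  define v where "v = (\<lambda>t z. p t x z - w z)"
  define D where "D = (\<lambda>t. \<Sum>z\<in>E. \<bar>v t z\<bar>)"
  have stationary: "(\<Sum>x\<in>E. w x * p t x z) = w z" if "t \<ge> 0" "z \<in> E" for t z
    using balance that by (rule detailed_balance_stationary)
  \<comment> \<open>Stationarity subtracts the same \<open>w\<close> at both times, so the
    difference \<open>v\<close> evolves under the semigroup by itself.\<close>
  have v_add: "v (s + t) z = (\<Sum>b\<in>E. v s b * p t b z)" if "s \<ge> 0" "t \<ge> 0" "z \<in> E" for s t z
    using that x
    by (simp add: stationary v_def chapman_kolmogorov left_diff_distrib sum_subtractf)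
  have decrease: "D (s + t) \<le> D s" if "s \<ge> 0" "t \<ge> 0" for s t
    using signed_mass_le[of t "v s"] that by (simp add: D_def v_add)
  have contract: "D (s + 1) \<le> r * D s" if "s \<ge> 0" for s
  proof -
    have "(\<Sum>z\<in>E. v s z) = 0" using that x mass by (simp add: v_def sum_subtractf row_sum)
    thus ?thesis using doeblin_contraction[of 1 \<delta> "v s"] \<delta>_le that by (simp add: D_def v_add r_def)
  qed
  have pow: "D (real n) \<le> r ^ n * D 0" for n
  proof (induction n)
    case (Suc n)
    have "D (real (Suc n)) \<le> r * D (real n)" using contract[of "real n"] by (simp add: add.commute)
    also have "\<dots> \<le> r * (r ^ n * D 0)" using Suc r0 by (intro mult_left_mono)
    finally show ?case by simp
  qed simp
  have "((\<lambda>t. r ^ nat \<lfloor>t\<rfloor> * D 0) \<longlongrightarrow> 0 * D 0) at_top"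
    using r0 r1
    by (intro tendsto_mult tendsto_const filterlim_compose[OF LIMSEQ_power_zero]
        filterlim_compose[OF filterlim_nat_sequentially filterlim_floor_sequentially]) auto
  moreover have "\<forall>\<^sub>F t in at_top. norm (v t y) \<le> r ^ nat \<lfloor>t\<rfloor> * D 0"
    using eventually_ge_at_top[of "0::real"]
  proof eventually_elim
    case (elim t)
    have "\<bar>v t y\<bar> \<le> D t"
      unfolding D_def using y finite_E by (intro member_le_sum[where f = "\<lambda>z. \<bar>v t z\<bar>"]) auto
    also have "D t = D (real (nat \<lfloor>t\<rfloor>) + frac t)" using elim by (simp add: frac_def)
    also have "\<dots> \<le> D (real (nat \<lfloor>t\<rfloor>))" by (intro decrease) auto
    also have "\<dots> \<le> r ^ nat \<lfloor>t\<rfloor> * D 0" by (rule pow)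
    finally show ?case by simp
  qed
  ultimately have "((\<lambda>t. v t y) \<longlongrightarrow> 0) at_top"
    by (intro Lim_null_comparison[of "\<lambda>t. v t y"]) auto
  hence "((\<lambda>t. v t y + w y) \<longlongrightarrow> 0 + w y) at_top" by (intro tendsto_intros)
  thus ?thesis by (simp add: v_def)
qed

end

section \<open>Law of the process at a fixed time\<close>

text \<open>The Markov property is applied with time 0 as the whole observed past; that conditioning
  event has probability 1, so conditioning on it changes nothing.\<close>

lemma (in prob_space) markov_law:
  assumes markov: "markov_with_transitions M E p S"
    and meas: "\<And>t. t \<ge> 0 \<Longrightarrow> S t \<in> measurable M (count_space E)"
    and init: "AE \<omega> in M. S 0 \<omega> = x" and x: "x \<in> E" and y: "y \<in> E" and t: "t > 0"
  shows "\<P>(\<omega> in M. S t \<omega> = y) = p t x y"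
proof -
  have [measurable]: "S 0 \<in> measurable M (count_space E)" "S t \<in> measurable M (count_space E)"
    using meas t by auto
  have [measurable]: "Measurable.pred M (\<lambda>\<omega>. S t \<omega> = y)" "Measurable.pred M (\<lambda>\<omega>. S 0 \<omega> = x)"
    by measurable
  have 0: "\<P>(\<omega> in M. S 0 \<omega> = x) = 1" using init by (simp add: prob_Collect_eq_1)
  \<comment> \<open>With \<open>n = 0\<close> only the times \<open>\<tau> 0 = 0\<close> and
    \<open>\<tau> 1 = t\<close> are compared; \<open>t > 0\<close> makes them strictly
    increasing.\<close>
  define \<tau> where "\<tau> = (\<lambda>k::nat. if k = 0 then 0 else t)"
  define \<zeta> where "\<zeta> = (\<lambda>k::nat. if k = 0 then x else y)"
  have "\<P>(\<omega> in M. S (\<tau> (Suc 0)) \<omega> = \<zeta> (Suc 0) \<bar> \<forall>k\<le>0. S (\<tau> k) \<omega> = \<zeta> k)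
      = p (\<tau> (Suc 0) - \<tau> 0) (\<zeta> 0) (\<zeta> (Suc 0))"
    by (rule markov[unfolded markov_with_transitions_def, rule_format])
      (use t x y 0 in \<open>auto simp: \<tau>_def \<zeta>_def\<close>)
  hence "\<P>(\<omega> in M. S t \<omega> = y \<and> S 0 \<omega> = x) = p t x y"
    using 0 by (simp add: \<tau>_def \<zeta>_def cond_prob_def)
  moreover have "\<P>(\<omega> in M. S t \<omega> = y \<and> S 0 \<omega> = x) = \<P>(\<omega> in M. S t \<omega> = y)"
    using init by (intro finite_measure_eq_AE) auto
  ultimately show ?thesis by simp
qed

section \<open>The exchange chain\<close>

lemma give_give: "i \<noteq> j \<Longrightarrow> give j i (give i j \<xi>) = \<xi>"
  by (auto simp: give_def)

text \<open>Stated for a general \<open>g\<close> to cover both the total fortune (\<open>g\<close>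
  the identity) and the total debt.\<close>

lemma sum_give:
  fixes g :: "int \<Rightarrow> int"
  assumes "i \<in> {1..N}" "j \<in> {1..N}" "i \<noteq> j"
  shows "(\<Sum>k\<in>{1..N}. g (give i j \<xi> k)) =
    (\<Sum>k\<in>{1..N}. g (\<xi> k)) + (g (\<xi> i - 1) - g (\<xi> i)) + (g (\<xi> j + 1) - g (\<xi> j))"
proof -
  have *: "(\<Sum>k\<in>{1..N}. h k) = h i + h j + (\<Sum>k\<in>{1..N}-{i}-{j}. h k)" for h :: "nat \<Rightarrow> int"
    using assms by (subst sum.remove[of _ i]; simp?; subst sum.remove[of _ j]; simp)
  have "(\<Sum>k\<in>{1..N}-{i}-{j}. g (give i j \<xi> k)) = (\<Sum>k\<in>{1..N}-{i}-{j}. g (\<xi> k))"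
    by (intro sum.cong) (auto simp: give_def)
  thus ?thesis
    unfolding *[of "\<lambda>k. g (give i j \<xi> k)"] *[of "\<lambda>k. g (\<xi> k)"]
    using assms by (simp add: give_def)
qed

lemma debt_give:
  assumes "i \<in> {1..N}" "j \<in> {1..N}" "i \<noteq> j"
  shows "debt N (give i j \<xi>) = debt N \<xi> + (if \<xi> i \<le> 0 then 1 else 0) - (if \<xi> j < 0 then 1 else 0)"
  using sum_give[OF assms, of "\<lambda>a. max (- a) 0" \<xi>] by (auto simp: debt_def)

lemma give_extensional:
  assumes "\<xi> \<in> {1..N} \<rightarrow>\<^sub>E UNIV" "i \<in> {1..N}" "j \<in> {1..N}"
  shows "give i j \<xi> \<in> {1..N} \<rightarrow>\<^sub>E UNIV"
  using assms by (auto simp: give_def PiE_def extensional_def)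

text \<open>A single debt is at most the total debt, and the positive parts of the fortunes add up
  to \<open>M\<close> plus the total debt; this yields both bounds on each fortune.\<close>

lemma configs_iff:
  "\<xi> \<in> configs N M B \<longleftrightarrow>
    \<xi> \<in> {1..N} \<rightarrow>\<^sub>E UNIV \<and> (\<Sum>i\<in>{1..N}. \<xi> i) = int M \<and> debt N \<xi> \<le> int B"
proof -
  have "- int B \<le> \<xi> i \<and> \<xi> i \<le> int M + int B"
    if sum: "(\<Sum>i\<in>{1..N}. \<xi> i) = int M" and debt: "debt N \<xi> \<le> int B" and i: "i \<in> {1..N}" for i
  proof -
    have "max (- \<xi> i) 0 \<le> debt N \<xi>"
      unfolding debt_def by (rule member_le_sum[OF i]) auto
    moreover have "max (\<xi> i) 0 \<le> (\<Sum>i\<in>{1..N}. max (\<xi> i) 0)"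
      by (rule member_le_sum[OF i]) auto
    moreover have "(\<Sum>i\<in>{1..N}. max (\<xi> i) 0) = int M + debt N \<xi>"
      unfolding debt_def sum[symmetric] sum.distrib[symmetric] by (intro sum.cong) auto
    ultimately show ?thesis using debt by linarith
  qed
  thus ?thesis unfolding configs_def by blast
qed

text \<open>A giver holding at least one dollar incurs no debt, so the total debt does not
  grow.\<close>

lemma give_in_configs:
  assumes "\<xi> \<in> configs N M B" "i \<in> {1..N}" "j \<in> {1..N}" "i \<noteq> j" "\<xi> i \<ge> 1"
  shows "give i j \<xi> \<in> configs N M B"
  using assms debt_give[of i N j \<xi>] sum_give[of i N j "\<lambda>a. a" \<xi>] give_extensional[of \<xi> N i j]
  by (auto simp: configs_iff)

section \<open>Detailed balance for \<open>theta\<close>\<close>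

context
  fixes f :: "real \<Rightarrow> real"
  assumes f_pos: "\<And>x. f x > 0"
begin

lemma theta_pos: "theta N B f \<xi> > 0"
  unfolding theta_def using f_pos by (intro prod_pos) auto

text \<open>The exchange removes the top factor of agent \<open>i\<close> and adds one for agent
  \<open>j\<close>; the lower bounds guarantee that these factors lie within the products.\<close>

lemma theta_give:
  assumes "i \<in> {1..N}" "j \<in> {1..N}" "i \<noteq> j" "- int B \<le> \<xi> i" "- int B \<le> \<xi> j"
  shows "theta N B f (give i j \<xi>) * f (real_of_int (\<xi> j + 1)) = theta N B f \<xi> * f (real_of_int (\<xi> i))"
proof -
  \<comment> \<open>The weight contributed by one agent holding \<open>a\<close> dollars.\<close>
  define g where "g = (\<lambda>a. \<Prod>j\<in>{- int B..a}. 1 / f (real_of_int j))"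
  have step: "g a * f (real_of_int a) = g (a - 1)" if "- int B \<le> a" for a
  proof -
    have "{- int B..a} = insert a {- int B..a - 1}" using that by auto
    thus ?thesis using f_pos[of "real_of_int a"] by (simp add: g_def)
  qed
  have *: "(\<Prod>k\<in>{1..N}. h k) = h i * h j * (\<Prod>k\<in>{1..N}-{i}-{j}. h k)" for h :: "nat \<Rightarrow> real"
    using assms by (subst prod.remove[of _ i]; simp?; subst prod.remove[of _ j]; simp)
  have "(\<Prod>k\<in>{1..N}-{i}-{j}. g (give i j \<xi> k)) = (\<Prod>k\<in>{1..N}-{i}-{j}. g (\<xi> k))"
    by (intro prod.cong) (auto simp: give_def)
  moreover have "give i j \<xi> i = \<xi> i - 1" "give i j \<xi> j = \<xi> j + 1"
    using assms by (auto simp: give_def)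
  moreover have "g (\<xi> i) * f (real_of_int (\<xi> i)) = g (\<xi> i - 1)"
    "g (\<xi> j + 1) * f (real_of_int (\<xi> j + 1)) = g (\<xi> j)"
    using assms step[of "\<xi> i"] step[of "\<xi> j + 1"] by auto
  \<comment> \<open>Here \<open>a\<close> and \<open>a'\<close> stand for the weight of agent
    \<open>i\<close> before and after the exchange, \<open>b\<close> and \<open>b'\<close> for that
    of agent \<open>j\<close>, and \<open>r\<close> for the other agents.\<close>
  moreover have "a' * b' * r * y = a * b * r * x" if "a * x = a'" "b' * y = b" for a a' b b' r x y :: real
    unfolding that[symmetric] by simp
  moreover have "theta N B f \<zeta> = g (\<zeta> i) * g (\<zeta> j) * (\<Prod>k\<in>{1..N}-{i}-{j}. g (\<zeta> k))" for \<zeta>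
    using *[of "\<lambda>k. g (\<zeta> k)"] unfolding theta_def g_def .
  ultimately show ?thesis by simp
qed

text \<open>Either both rates vanish, or both are given by \<open>f\<close> and the identity is
  \<open>theta_give\<close> divided by \<open>N\<close>.\<close>

lemma give_rate_balance:
  assumes "\<xi> \<in> configs N M B" "give i j \<xi> \<in> configs N M B" "i \<in> {1..N}" "j \<in> {1..N}" "i \<noteq> j"
  shows "theta N B f \<xi> * give_rate N B f i \<xi> =
    theta N B f (give i j \<xi>) * give_rate N B f j (give i j \<xi>)"
proof -
  have le: "- int B \<le> \<xi> i" "- int B \<le> \<xi> j" "debt N \<xi> \<le> int B" "debt N (give i j \<xi>) \<le> int B"
    using assms by (auto simp: configs_def)
  have [simp]: "give i j \<xi> j = \<xi> j + 1" using assms by (simp add: give_def)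
  \<comment> \<open>If \<open>\<xi> i \<ge> 1\<close> and \<open>\<xi> j < 0\<close>, the repayment
    leaves a dollar in the bank. If \<open>\<xi> i \<le> 0\<close> and
    \<open>\<xi> j \<ge> 0\<close>, the new debt is within the limit only if the bank had a dollar
    before. If \<open>\<xi> i \<le> 0\<close> and \<open>\<xi> j < 0\<close>, the cash is
    unchanged.\<close>
  have "(\<xi> i \<ge> 1 \<or> bank_cash N B \<xi> \<ge> 1) \<longleftrightarrow> (\<xi> j + 1 \<ge> 1 \<or> bank_cash N B (give i j \<xi>) \<ge> 1)"
    using le debt_give[OF assms(3-5), of \<xi>] by (auto simp: bank_cash_def split: if_splits)
  thus ?thesis
    using theta_give[where \<xi>=\<xi> and B=B, OF assms(3-5) le(1,2)] by (simp add: give_rate_def)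
qed

text \<open>Each pair \<open>(i, j)\<close> leading from \<xi> to \<eta> is matched with the pair
  \<open>(j, i)\<close> leading back.\<close>

lemma theta_detailed_balance:
  assumes "\<xi> \<in> configs N M B" "\<eta> \<in> configs N M B"
  shows "theta N B f \<xi> * exchange_rate N B f \<xi> \<eta> = theta N B f \<eta> * exchange_rate N B f \<eta> \<xi>"
  unfolding exchange_rate_def sum_distrib_left
  by (rule sum.reindex_bij_witness[of _ "\<lambda>(i, j). (j, i)" "\<lambda>(i, j). (j, i)"])
    (use assms in \<open>auto simp: give_give give_rate_balance\<close>)

lemma give_rate_nonneg: "give_rate N B f i \<xi> \<ge> 0"
  using f_pos[of "real_of_int (\<xi> i)"] by (simp add: give_rate_def)

lemma exchange_rate_pos:
  assumes "i \<in> {1..N}" "j \<in> {1..N}" "i \<noteq> j" "\<xi> i \<ge> 1"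
  shows "exchange_rate N B f \<xi> (give i j \<xi>) > 0"
proof -
  let ?A = "{(i', j'). i' \<in> {1..N} \<and> j' \<in> {1..N} \<and> i' \<noteq> j' \<and> give i' j' \<xi> = give i j \<xi>}"
  have "finite ?A" by (rule finite_subset[of _ "{1..N} \<times> {1..N}"]) auto
  moreover have "give_rate N B f i \<xi> > 0" using assms f_pos by (simp add: give_rate_def)
  ultimately show ?thesis
    unfolding exchange_rate_def using assms
    by (intro sum_pos2[where i = "(i, j)"]) (auto simp: give_rate_nonneg)
qed

section \<open>Irreducibility of the exchange chain\<close>

definition exchange_edges :: "nat \<Rightarrow> nat \<Rightarrow> nat \<Rightarrow> ((nat \<Rightarrow> int) \<times> (nat \<Rightarrow> int)) set" where
  "exchange_edges N M B =
    {(\<xi>, \<eta>). \<xi> \<in> configs N M B \<and> \<eta> \<in> configs N M B \<and> exchange_rate N B f \<xi> \<eta> > 0}"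

text \<open>The weights are positive, so detailed balance carries positivity of a rate over to the
  reverse rate.\<close>

lemma sym_exchange_edges: "sym (exchange_edges N M B)"
proof (rule symI)
  fix \<xi> \<eta> assume e: "(\<xi>, \<eta>) \<in> exchange_edges N M B"
  hence "theta N B f \<xi> * exchange_rate N B f \<xi> \<eta> > 0"
    by (simp add: exchange_edges_def theta_pos)
  hence "theta N B f \<eta> * exchange_rate N B f \<eta> \<xi> > 0"
    using theta_detailed_balance[of \<xi> N M B \<eta>] e by (simp add: exchange_edges_def)
  hence "exchange_rate N B f \<eta> \<xi> > 0"
    using theta_pos[of N B \<eta>] by (simp add: zero_less_mult_iff)
  thus "(\<eta>, \<xi>) \<in> exchange_edges N M B" using e by (auto simp: exchange_edges_def)
qed

lemma exchange_edge_give: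
  assumes "\<xi> \<in> configs N M B" "i \<in> {1..N}" "j \<in> {1..N}" "i \<noteq> j" "\<xi> i \<ge> 1"
  shows "(\<xi>, give i j \<xi>) \<in> exchange_edges N M B"
  using assms give_in_configs[OF assms] exchange_rate_pos by (simp add: exchange_edges_def)

definition concentrated :: "nat \<Rightarrow> nat \<Rightarrow> nat \<Rightarrow> int" where
  "concentrated N M = (\<lambda>k\<in>{1..N}. if k = 1 then int M else 0)"

text \<open>Positive fortunes are collected by agent 1 first and debts are paid afterwards. Once no
  other agent has money, agent 1 holds at least \<open>M > 0\<close> dollars, so every giver along
  the path has a dollar to give.\<close>

lemma concentrated_reachable:
  assumes "N > 0" "M > 0" "\<xi> \<in> configs N M B"
  shows "(\<xi>, concentrated N M) \<in> (exchange_edges N M B)\<^sup>*"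
  using assms(3)
proof (induction "nat (\<Sum>k\<in>{1..N}-{1}. \<bar>\<xi> k\<bar>)" arbitrary: \<xi> rule: less_induct)
  case less
  have one: "1 \<in> {1..N}" using assms by simp
  have total: "\<xi> 1 + (\<Sum>k\<in>{1..N}-{1}. \<xi> k) = int M"
    using less.prems sum.remove[of "{1..N}" 1 \<xi>] one by (simp add: configs_iff)
  \<comment> \<open>The induction step for any move that changes only agents 1 and \<open>k\<close>
    and brings \<open>k\<close> closer to 0.\<close>
  have reach: ?case
    if k: "k \<in> {1..N}" "k \<noteq> 1" and edge: "(\<xi>, \<eta>) \<in> exchange_edges N M B"
      and same: "\<And>l. l \<noteq> 1 \<Longrightarrow> l \<noteq> k \<Longrightarrow> \<eta> l = \<xi> l" and closer: "\<bar>\<eta> k\<bar> < \<bar>\<xi> k\<bar>" for k \<eta>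
  proof -
    have "\<bar>\<eta> l\<bar> \<le> \<bar>\<xi> l\<bar>" if "l \<noteq> 1" for l using that same[of l] closer by (cases "l = k") auto
    hence "(\<Sum>l\<in>{1..N}-{1}. \<bar>\<eta> l\<bar>) < (\<Sum>l\<in>{1..N}-{1}. \<bar>\<xi> l\<bar>)"
      using k closer by (intro sum_strict_mono_ex1) auto
    \<comment> \<open>Positivity of the larger sum is what keeps the inequality strict under
      \<open>nat\<close>.\<close>
    moreover from this have "0 < (\<Sum>l\<in>{1..N}-{1}. \<bar>\<xi> l\<bar>)"
      by (rule le_less_trans[rotated]) (intro sum_nonneg, auto)
    ultimately have "(\<eta>, concentrated N M) \<in> (exchange_edges N M B)\<^sup>*"
      using edge by (intro less.hyps) (auto simp: exchange_edges_def simp del: One_nat_def)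
    with edge show ?thesis by (rule converse_rtrancl_into_rtrancl)
  qed
  consider (pos) k where "k \<in> {1..N}" "k \<noteq> 1" "\<xi> k \<ge> 1"
    | (neg) k where "k \<in> {1..N}" "k \<noteq> 1" "\<xi> k < 0" "\<forall>l\<in>{1..N}-{1}. \<xi> l \<le> 0"
    | (zero) "\<forall>k\<in>{1..N}-{1}. \<xi> k = 0"
  proof -
    assume *: "\<And>k. k \<in> {1..N} \<Longrightarrow> k \<noteq> 1 \<Longrightarrow> \<xi> k \<ge> 1 \<Longrightarrow> thesis"
      "\<And>k. k \<in> {1..N} \<Longrightarrow> k \<noteq> 1 \<Longrightarrow> \<xi> k < 0 \<Longrightarrow> \<forall>l\<in>{1..N}-{1}. \<xi> l \<le> 0 \<Longrightarrow> thesis"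
      "\<forall>k\<in>{1..N}-{1}. \<xi> k = 0 \<Longrightarrow> thesis"
    show thesis
    proof (cases "\<forall>l\<in>{1..N}-{1}. \<xi> l \<le> 0")
      case True
      show thesis
      proof (cases "\<forall>k\<in>{1..N}-{1}. \<xi> k = 0")
        case False
        then obtain k where "k \<in> {1..N}" "k \<noteq> 1" "\<xi> k \<noteq> 0" by blast
        thus thesis using *(2)[of k] True by (simp add: order.not_eq_order_implies_strict)
      qed (rule *(3))
    next
      case False
      then obtain k where "k \<in> {1..N}" "k \<noteq> 1" "\<not> \<xi> k \<le> 0" by blast
      thus thesis using *(1)[of k] by simp
    qed
  qed
  thus ?case
  proof cases
    case pos
    show ?thesis
      by (rule reach[OF pos(1,2) exchange_edge_give[OF less.prems pos(1) one pos(2,3)]])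
        (use pos in \<open>auto simp: give_def\<close>)
  next
    case neg
    have "(\<Sum>k\<in>{1..N}-{1}. \<xi> k) \<le> 0" using neg by (intro sum_nonpos) auto
    hence "\<xi> 1 \<ge> 1" using total assms(2) by linarith
    from exchange_edge_give[OF less.prems one neg(1) neg(2)[symmetric] this] show ?thesis
      by (rule reach[OF neg(1,2)]) (use neg in \<open>auto simp: give_def\<close>)
  next
    case zero
    hence "\<xi> 1 = int M" using total by simp
    moreover have "\<xi> \<in> extensional {1..N}" using less.prems by (auto simp: configs_iff PiE_def)
    ultimately have "\<xi> = concentrated N M"
      using zero by (intro extensionalityI[of _ "{1..N}"]) (auto simp: concentrated_def)
    thus ?thesis by simp
  qed
qed

text \<open>Both configurations reach \<open>concentrated N M\<close>, and symmetry reverses the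
  second path.\<close>

lemma exchange_irreducible:
  assumes "N > 0" "M > 0" "\<xi> \<in> configs N M B" "\<eta> \<in> configs N M B"
  shows "(\<xi>, \<eta>) \<in> (exchange_edges N M B)\<^sup>*"
  using concentrated_reachable[OF assms(1-3)] concentrated_reachable[OF assms(1,2,4)]
    sym_rtrancl[OF sym_exchange_edges, of N M B]
  by (meson rtrancl_trans symD)

end

section \<open>Limit law of the fortune of one agent\<close>

theorem theorem1:
  fixes N \<mu> \<nu> M B i :: nat
    and n :: int
    and f :: "real \<Rightarrow> real"
    and \<Omega> :: "'w measure"
    and S :: "real \<Rightarrow> 'w \<Rightarrow> nat \<Rightarrow> int"
    and \<xi>\<^sub>0 :: "nat \<Rightarrow> int"
  assumes "N > 0" and "\<mu> > 0" and "\<nu> > 0"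
    and "M = N * \<mu>" and "B = N * \<mu> * \<nu>"
    and "\<And>x. f x > 0"
    and "biased_exchange_process \<Omega> N M B f S"
    and "\<xi>\<^sub>0 \<in> configs N M B"
    and "AE \<omega> in \<Omega>. S 0 \<omega> = \<xi>\<^sub>0"
    and "i \<in> {1..N}"
  shows "((\<lambda>t. \<P>(\<omega> in \<Omega>. S t \<omega> i = n)) \<longlongrightarrow>
            (\<Sum>\<xi> | \<xi> \<in> configs N M B \<and> \<xi> i = n. stat_weight N M B f \<xi>)) at_top
    \<and> (\<Sum>\<xi> | \<xi> \<in> configs N M B \<and> \<xi> i = n. stat_weight N M B f \<xi>)
        = (\<Sum>\<xi> | \<xi> \<in> configs N M B \<and> \<xi> i = n. theta N B f \<xi>)
            / (\<Sum>\<xi>\<in>configs N M B. theta N B f \<xi>)"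
proof
  let ?C = "configs N M B"
  let ?w = "stat_weight N M B f"
  have M: "M > 0" using assms by simp
  obtain p where "prob_space \<Omega>" and fin: "finite ?C"
    and meas: "\<And>t. t \<ge> 0 \<Longrightarrow> S t \<in> measurable \<Omega> (count_space ?C)"
    and tf: "transition_function ?C p" and rates: "has_jump_rates ?C p (exchange_rate N B f)"
    and markov: "markov_with_transitions \<Omega> ?C p S"
    using assms(7) unfolding biased_exchange_process_def finite_ctmc_def by blast
  interpret prob_space \<Omega> by fact
  interpret finite_transition ?C p "exchange_rate N B f"
    using fin tf rates by unfold_locales
  \<comment> \<open>The initial state shows that the sum is over a nonempty set, so the
    normalisation is legitimate.\<close>
  have theta_sum: "(\<Sum>\<xi>\<in>?C. theta N B f \<xi>) > 0"
    using fin assms(8) by (intro sum_pos) (auto intro: theta_pos assms(6))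
  have conv: "((\<lambda>t. p t \<xi>\<^sub>0 \<xi>) \<longlongrightarrow> ?w \<xi>) at_top" if \<xi>: "\<xi> \<in> ?C" for \<xi>
  proof (rule convergence[OF _ _ _ assms(8) \<xi>])
    show "?w \<xi> * exchange_rate N B f \<xi> \<eta> = ?w \<eta> * exchange_rate N B f \<eta> \<xi>"
      if "\<xi> \<in> ?C" "\<eta> \<in> ?C" for \<xi> \<eta>
      using theta_detailed_balance[OF assms(6) that] by (simp add: stat_weight_def)
    show "(\<xi>, \<eta>) \<in> {(a, b). a \<in> ?C \<and> b \<in> ?C \<and> exchange_rate N B f a b > 0}\<^sup>*"
      if "\<xi> \<in> ?C" "\<eta> \<in> ?C" for \<xi> \<eta>
      using exchange_irreducible[OF assms(6,1) M that] unfolding exchange_edges_def[OF assms(6)] .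
    show "(\<Sum>\<xi>\<in>?C. ?w \<xi>) = 1"
      using theta_sum by (simp add: stat_weight_def flip: sum_divide_distrib)
  qed
  have "((\<lambda>t. \<Sum>\<xi> | \<xi> \<in> ?C \<and> \<xi> i = n. p t \<xi>\<^sub>0 \<xi>) \<longlongrightarrow> (\<Sum>\<xi> | \<xi> \<in> ?C \<and> \<xi> i = n. ?w \<xi>)) at_top"
    by (intro tendsto_sum conv) auto
  moreover have "\<forall>\<^sub>F t in at_top.
      (\<Sum>\<xi> | \<xi> \<in> ?C \<and> \<xi> i = n. p t \<xi>\<^sub>0 \<xi>) = \<P>(\<omega> in \<Omega>. S t \<omega> i = n)"
    using eventually_gt_at_top[of "0::real"]
  proof eventually_elim
    case (elim t)
    have [measurable]: "S t \<in> measurable \<Omega> (count_space ?C)" using meas elim by simp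
    have "S t \<omega> \<in> ?C" if "\<omega> \<in> space \<Omega>" for \<omega>
      using measurable_space[OF meas[of t] that] elim by simp
    \<comment> \<open>Measurability into \<open>count_space ?C\<close> places every sample point in
      \<open>?C\<close>, so the event is a finite disjoint union over full configurations.\<close>
    hence "{\<omega> \<in> space \<Omega>. S t \<omega> i = n} =
        (\<Union>\<xi>\<in>{\<xi> \<in> ?C. \<xi> i = n}. {\<omega> \<in> space \<Omega>. S t \<omega> = \<xi>})" by auto
    also have "prob \<dots> = (\<Sum>\<xi> | \<xi> \<in> ?C \<and> \<xi> i = n. \<P>(\<omega> in \<Omega>. S t \<omega> = \<xi>))"
      using fin by (intro finite_measure_finite_Union) (auto simp: disjoint_family_on_def)
    also have "\<dots> = (\<Sum>\<xi> | \<xi> \<in> ?C \<and> \<xi> i = n. p t \<xi>\<^sub>0 \<xi>)"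
      using markov_law[OF markov meas assms(9,8) _ elim] by (intro sum.cong) auto
    finally show ?case by simp
  qed
  ultimately show "((\<lambda>t. \<P>(\<omega> in \<Omega>. S t \<omega> i = n)) \<longlongrightarrow>
      (\<Sum>\<xi> | \<xi> \<in> ?C \<and> \<xi> i = n. ?w \<xi>)) at_top"
    by (rule Lim_transform_eventually)
  show "(\<Sum>\<xi> | \<xi> \<in> ?C \<and> \<xi> i = n. ?w \<xi>) =
      (\<Sum>\<xi> | \<xi> \<in> ?C \<and> \<xi> i = n. theta N B f \<xi>) / (\<Sum>\<xi>\<in>?C. theta N B f \<xi>)"
    by (simp add: stat_weight_def sum_divide_distrib)
qed

end
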